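(* Assume that the MPSC weak constant rank condition (MPSC-WCR) holds at $\bar{x}\in\mathcal{F}$. Then the MPSC-tailored weak second-order constraint qualification (MPSC-WSOCQ) holds at $\bar{x}$.
   Context: (MPSC) is the problem: minimize $f(x)$ over $x\in\mathbb{R}^n$ subject to $g_i(x)\le 0$ ($i=1,\dots,m$), $h_j(x)=0$ ($j=1,\dots,p$), $G_k(x)H_k(x)=0$ ($k=1,\dots,l$), where $f,g_i,h_j,G_k,H_k:\mathbb{R}^n\to\mathbb{R}$ are twice continuously differentiable. $\mathcal{F}$ denotes its feasible set. For a feasible point $\bar{x}$: $\mathcal{I}_h=\{1,\dots,p\}$, $\mathcal{I}_g=\{i: g_i(\bar{x})=0\}$, $\mathcal{I}_G=\{k: G_k(\bar{x})=0,\,H_k(\bar{x})\neq0\}$, $\mathcal{I}_H=\{k: G_k(\bar{x})\ne0,\,H_k(\bar{x})=0\}$, $\mathcal{I}_{GH}=\{k: G_k(\bar{x})=H_k(\bar{x})=0\}$. MPSC-WCR holds at $\bar{x}$ if there is $\varepsilon>0$ such that the family $\{\nabla g_i(x)\}_{i\in\mathcal{I}_g}\cup\{\nabla h_j(x)\}_{j\in\mathcal{I}_h}\cup\{\nabla G_k(x)\}_{k\in\mathcal{I}_G\cup\mathcal{I}_{GH}}\cup\{\nabla H_k(x)\}_{k\in\mathcal{I}_H\cup\mathcal{I}_{GH}}$ has the same rank for all $x$ with $\|x-\bar{x}\|<\varepsilon$. Critical subspace: $\tilde{\mathcal{C}}^{MPSC}_{\mathcal{F}}(\bar{x})$ is the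 set of $d\in\mathbb{R}^n$ with $\nabla g_i(\bar{x})^\top d=0$ ($i\in\mathcal{I}_g$), $\nabla h_j(\bar{x})^\top d=0$ ($j\in\mathcal{I}_h$), $\nabla G_k(\bar{x})^\top d=0$ ($k\in\mathcal{I}_G\cup\mathcal{I}_{GH}$), $\nabla H_k(\bar{x})^\top d=0$ ($k\in\mathcal{I}_H\cup\mathcal{I}_{GH}$). MPSC-WSOCQ holds at $\bar{x}$ if for every nonzero $\tilde d\in\tilde{\mathcal{C}}^{MPSC}_{\mathcal{F}}(\bar{x})$ there exist $\delta>0$, sets $\mathcal{J},\mathcal{K}\subseteq\mathcal{I}_{GH}$ and a twice differentiable arc $\zeta:[0,\delta)\to\mathbb{R}^n$ such that $\zeta(t)\in\mathcal{F}$ for all $t\in[0,\delta)$; $\zeta(0)=\bar{x}$ and $\zeta'_+(0)=\tilde d$ (right derivative); and for all $t\in[0,\delta)$: $g_i(\zeta(t))=0$ for $i\in\mathcal{I}_g$, $G_k(\zeta(t))=0$ for $k\in\mathcal{I}_G\cup\mathcal{J}$, $H_k(\zeta(t))=0$ for $k\in\mathcal{I}_H\cup\mathcal{K}$. *)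

theory Defs
  imports "HOL-Analysis.Analysis"
begin

definition gradient :: "('a::euclidean_space \<Rightarrow> real) \<Rightarrow> 'a \<Rightarrow> 'a" where
  "gradient f x = (THE D. GDERIV f x :> D)"

lemma gradient_eqI:
  assumes "GDERIV f x :> D"
  shows "gradient f x = D"
  unfolding gradient_def
proof (rule the_equality)
  fix D' assume "GDERIV f x :> D'"
  then have "(\<lambda>h. h \<bullet> D') = (\<lambda>h. h \<bullet> D)"
    using assms unfolding gderiv_def by (rule has_derivative_unique)
  then show "D' = D"
    by (metis vector_eq_ldot)
qed (rule assms)

text \<open>The second derivative is taken as the derivative of the gradient map, and it is continuous
  with respect to the operator norm.\<close>

definition twice_continuously_differentiable :: "('a::euclidean_space \<Rightarrow> real) \<Rightarrow> bool" where
  "twice_continuously_differentiable f \<longleftrightarrow>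
    (\<exists>(f' :: 'a \<Rightarrow> 'a) (f'' :: 'a \<Rightarrow> 'a \<Rightarrow>\<^sub>L 'a).
       (\<forall>x. GDERIV f x :> f' x) \<and>
       (\<forall>x. (f' has_derivative blinfun_apply (f'' x)) (at x)) \<and>
       continuous_on UNIV f'')"

text \<open>On \<open>{0..<\<delta>}\<close> the derivatives at the endpoint \<open>0\<close> are one-sided.\<close>

definition twice_differentiable_arc_on :: "(real \<Rightarrow> 'a::real_normed_vector) \<Rightarrow> real set \<Rightarrow> bool" where
  "twice_differentiable_arc_on \<zeta> S \<longleftrightarrow>
    (\<exists>\<zeta>' \<zeta>''. \<forall>t\<in>S.
       (\<zeta> has_vector_derivative \<zeta>' t) (at t within S) \<and>
       (\<zeta>' has_vector_derivative \<zeta>'' t) (at t within S))"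

text \<open>A mathematical program with switching constraints: minimize \<open>objective\<close> subject to
  \<open>con_g i x \<le> 0\<close>, \<open>con_h j x = 0\<close> and \<open>sw_G k x * sw_H k x = 0\<close>. The constraint functions are
  only meaningful at the indices \<open>{1..num_g}\<close>, \<open>{1..num_h}\<close> and \<open>{1..num_sw}\<close>; their values at other
  indices are never used. Each of the three numbers may be zero.\<close>

record ('n::finite) mpsc =
  objective :: "real ^ 'n \<Rightarrow> real"
  num_g :: nat
  con_g :: "nat \<Rightarrow> real ^ 'n \<Rightarrow> real"
  num_h :: nat
  con_h :: "nat \<Rightarrow> real ^ 'n \<Rightarrow> real"
  num_sw :: nat
  sw_G :: "nat \<Rightarrow> real ^ 'n \<Rightarrow> real"
  sw_H :: "nat \<Rightarrow> real ^ 'n \<Rightarrow> real"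

definition mpsc_C2 :: "('n::finite) mpsc \<Rightarrow> bool" where
  "mpsc_C2 P \<longleftrightarrow>
    twice_continuously_differentiable (objective P) \<and>
    (\<forall>i\<in>{1..num_g P}. twice_continuously_differentiable (con_g P i)) \<and>
    (\<forall>j\<in>{1..num_h P}. twice_continuously_differentiable (con_h P j)) \<and>
    (\<forall>k\<in>{1..num_sw P}. twice_continuously_differentiable (sw_G P k) \<and>
                        twice_continuously_differentiable (sw_H P k))"

definition feasible_set :: "('n::finite) mpsc \<Rightarrow> (real ^ 'n) set" where
  "feasible_set P = {x.
    (\<forall>i\<in>{1..num_g P}. con_g P i x \<le> 0) \<and>
    (\<forall>j\<in>{1..num_h P}. con_h P j x = 0) \<and>
    (\<forall>k\<in>{1..num_sw P}. sw_G P k x * sw_H P k x = 0)}"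

definition idx_h :: "('n::finite) mpsc \<Rightarrow> nat set" where
  "idx_h P = {1..num_h P}"

definition idx_g :: "('n::finite) mpsc \<Rightarrow> real ^ 'n \<Rightarrow> nat set" where
  "idx_g P xbar = {i \<in> {1..num_g P}. con_g P i xbar = 0}"

definition idx_G :: "('n::finite) mpsc \<Rightarrow> real ^ 'n \<Rightarrow> nat set" where
  "idx_G P xbar = {k \<in> {1..num_sw P}. sw_G P k xbar = 0 \<and> sw_H P k xbar \<noteq> 0}"

definition idx_H :: "('n::finite) mpsc \<Rightarrow> real ^ 'n \<Rightarrow> nat set" where
  "idx_H P xbar = {k \<in> {1..num_sw P}. sw_G P k xbar \<noteq> 0 \<and> sw_H P k xbar = 0}"

definition idx_GH :: "('n::finite) mpsc \<Rightarrow> real ^ 'n \<Rightarrow> nat set" where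
  "idx_GH P xbar = {k \<in> {1..num_sw P}. sw_G P k xbar = 0 \<and> sw_H P k xbar = 0}"

text \<open>The index sets belong to the fixed point \<open>xbar\<close>, whereas the gradients are evaluated at the
  varying point \<open>x\<close>.\<close>

definition active_gradients :: "('n::finite) mpsc \<Rightarrow> real ^ 'n \<Rightarrow> real ^ 'n \<Rightarrow> (real ^ 'n) set" where
  "active_gradients P xbar x =
    (\<lambda>i. gradient (con_g P i) x) ` idx_g P xbar \<union>
    (\<lambda>j. gradient (con_h P j) x) ` idx_h P \<union>
    (\<lambda>k. gradient (sw_G P k) x) ` (idx_G P xbar \<union> idx_GH P xbar) \<union>
    (\<lambda>k. gradient (sw_H P k) x) ` (idx_H P xbar \<union> idx_GH P xbar)"

text \<open>The rank of a family of vectors is the dimension of its span, so repeated members of the family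
  are irrelevant and the family may be represented by its range.\<close>

definition MPSC_WCR :: "('n::finite) mpsc \<Rightarrow> real ^ 'n \<Rightarrow> bool" where
  "MPSC_WCR P xbar \<longleftrightarrow>
    (\<exists>\<epsilon>>0. \<exists>r. \<forall>x. norm (x - xbar) < \<epsilon> \<longrightarrow> dim (active_gradients P xbar x) = r)"

definition critical_subspace :: "('n::finite) mpsc \<Rightarrow> real ^ 'n \<Rightarrow> (real ^ 'n) set" where
  "critical_subspace P xbar = {d.
    (\<forall>i\<in>idx_g P xbar. gradient (con_g P i) xbar \<bullet> d = 0) \<and>
    (\<forall>j\<in>idx_h P. gradient (con_h P j) xbar \<bullet> d = 0) \<and>
    (\<forall>k\<in>idx_G P xbar \<union> idx_GH P xbar. gradient (sw_G P k) xbar \<bullet> d = 0) \<and>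
    (\<forall>k\<in>idx_H P xbar \<union> idx_GH P xbar. gradient (sw_H P k) xbar \<bullet> d = 0)}"

definition MPSC_WSOCQ :: "('n::finite) mpsc \<Rightarrow> real ^ 'n \<Rightarrow> bool" where
  "MPSC_WSOCQ P xbar \<longleftrightarrow>
    (\<forall>d\<in>critical_subspace P xbar. d \<noteq> 0 \<longrightarrow>
      (\<exists>\<delta>>0. \<exists>J K. \<exists>\<zeta> :: real \<Rightarrow> real ^ 'n.
         J \<subseteq> idx_GH P xbar \<and> K \<subseteq> idx_GH P xbar \<and>
         twice_differentiable_arc_on \<zeta> {0..<\<delta>} \<and>
         (\<forall>t\<in>{0..<\<delta>}. \<zeta> t \<in> feasible_set P) \<and>
         \<zeta> 0 = xbar \<and>
         (\<zeta> has_vector_derivative d) (at_right 0) \<and>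
         (\<forall>t\<in>{0..<\<delta>}.
            (\<forall>i\<in>idx_g P xbar. con_g P i (\<zeta> t) = 0) \<and>
            (\<forall>k\<in>idx_G P xbar \<union> J. sw_G P k (\<zeta> t) = 0) \<and>
            (\<forall>k\<in>idx_H P xbar \<union> K. sw_H P k (\<zeta> t) = 0))))"

end

theory Submission imports Defs begin

text \<open>Take \<open>J = K = idx_GH P xbar\<close>. All active constraints then become equations \<open>\<phi> = 0\<close>, a critical
  direction is one orthogonal to every gradient \<open>\<nabla>\<phi>(xbar)\<close>, and by WCR these gradients span a space
  of constant dimension near \<open>xbar\<close>. So the claim reduces to a constant rank theorem: through
  \<open>xbar\<close> there is a twice differentiable arc in the common zero set with any prescribed velocity
  orthogonal to the gradients (\<open>constant_rank_level_set_arc\<close>).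

  Choose equations whose gradients at \<open>xbar\<close> form a basis of the span of all the gradients. For
  these the arc comes from the inverse function theorem (\<open>independent_level_set_arc\<close>): the
  equations are completed to a map \<open>F\<close> of the whole space into itself with \<open>F(xbar) = 0\<close> and derivative
  the identity at \<open>xbar\<close>, and the arc is \<open>t \<mapsto> F\<^sup>-\<^sup>1(t d)\<close>. Its velocity solves the linear equation
  \<open>DF(\<zeta>(t)) \<zeta>'(t) = d\<close>, whose coefficients are differentiable in \<open>t\<close>; hence the velocity is
  differentiable too (\<open>linear_solution_has_vector_derivative\<close>).

  The chosen gradients stay independent nearby (\<open>eventually_independent_family\<close>), so by constancy of
  the rank they still span the other gradients at every point of the arc. The velocity is orthogonal to
  the chosen gradients, because the chosen functions vanish along the arc; hence it is orthogonal to
  all of them, and every remaining function is constant along the arc, with the value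
  \<open>0\<close> that it has at \<open>xbar\<close>. Inactive inequalities stay strict for small \<open>t\<close>.\<close>

section \<open>Gradients of twice continuously differentiable functions\<close>

lemma C2_has_derivative:
  fixes \<phi> :: "'a::euclidean_space \<Rightarrow> real"
  assumes "twice_continuously_differentiable \<phi>"
  shows "(\<phi> has_derivative (\<lambda>h. h \<bullet> gradient \<phi> x)) (at x)"
  using assms gradient_eqI unfolding twice_continuously_differentiable_def
  by (metis gderiv_def)

lemma C2_gradient_differentiable:
  fixes \<phi> :: "'a::euclidean_space \<Rightarrow> real"
  assumes "twice_continuously_differentiable \<phi>"
  shows "gradient \<phi> differentiable (at x)"
proof -
  obtain f' f'' where f': "\<And>x. GDERIV \<phi> x :> f' x"
    and f'': "\<And>x. (f' has_derivative blinfun_apply (f'' x)) (at x)"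
    using assms unfolding twice_continuously_differentiable_def by blast
  have "gradient \<phi> = f'"
    using f' gradient_eqI by blast
  with f'' show ?thesis
    unfolding differentiable_def by blast
qed

lemma C2_isCont:
  fixes \<phi> :: "'a::euclidean_space \<Rightarrow> real"
  assumes "twice_continuously_differentiable \<phi>"
  shows "isCont \<phi> x"
  using C2_has_derivative[OF assms] has_derivative_continuous by blast

lemma C2_gradient_isCont:
  fixes \<phi> :: "'a::euclidean_space \<Rightarrow> real"
  assumes "twice_continuously_differentiable \<phi>"
  shows "isCont (gradient \<phi>) x"
  using C2_gradient_differentiable[OF assms] by (rule differentiable_imp_continuous_within)

lemma C2_compose_vector_derivative:
  fixes \<phi> :: "'a::euclidean_space \<Rightarrow> real"
  assumes "twice_continuously_differentiable \<phi>"
    and "(\<zeta> has_vector_derivative u) (at t within S)"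
  shows "((\<lambda>s. \<phi> (\<zeta> s)) has_vector_derivative (u \<bullet> gradient \<phi> (\<zeta> t))) (at t within S)"
  using has_derivative_compose[OF assms(2)[unfolded has_vector_derivative_def]
      C2_has_derivative[OF assms(1)]]
  by (simp add: has_vector_derivative_def)

section \<open>Independent families\<close>

text \<open>Independent vectors admit linear functionals with arbitrary prescribed values; the Riesz
  representation of the functional that singles out \<open>u b\<close> is \<open>w b\<close>.\<close>

lemma dual_family:
  fixes u :: "'i \<Rightarrow> 'a::euclidean_space"
  assumes "independent (u ` A)" and "inj_on u A"
  obtains w where "\<And>a b. a \<in> A \<Longrightarrow> b \<in> A \<Longrightarrow> u a \<bullet> w b = (if a = b then 1 else 0)"
proof -
  have "\<exists>w. \<forall>a\<in>A. u a \<bullet> w = (if a = b then 1 else 0)" if "b \<in> A" for b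
  proof -
    obtain g :: "'a \<Rightarrow> real" where g: "linear g"
      "\<forall>y \<in> u ` A. g y = (if y = u b then 1 else 0)"
      using linear_independent_extend[OF assms(1), of "\<lambda>y. if y = u b then 1 else 0"] by blast
    have "u a \<bullet> adjoint g 1 = (if a = b then 1 else 0)" if "a \<in> A" for a
      using adjoint_works[OF g(1), of "u a" 1] g(2) that \<open>b \<in> A\<close> assms(2)
      by (auto simp: inj_on_eq_iff)
    then show ?thesis by blast
  qed
  then show thesis
    using that by metis
qed

text \<open>For \<open>y = T h\<close> with a linear map \<open>T\<close> close to the identity, the bound excludes a kernel.\<close>

lemma near_identity_bound:
  fixes y h :: "'a::real_normed_vector"
  assumes "norm (y - h) \<le> norm h / 2"
  shows "norm h \<le> 2 * norm y"
  using assms norm_triangle_ineq2[of h y] by (simp add: norm_minus_commute)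

text \<open>With a dual family \<open>w\<close>, the map \<open>T\<close> that adds \<open>\<Sum>b. (h \<bullet> w b) (v b x - u b)\<close> to \<open>h\<close> carries every \<open>u a\<close>
  to \<open>v a x\<close>. It tends to the identity, hence is eventually injective and carries the independent
  family \<open>u\<close> to an independent family.\<close>

lemma eventually_independent_family:
  fixes u :: "'i \<Rightarrow> 'a::euclidean_space"
  assumes fin: "finite A" and ind: "independent (u ` A)" and inj: "inj_on u A"
    and lim: "\<And>a. a \<in> A \<Longrightarrow> (v a \<longlongrightarrow> u a) F"
  shows "\<forall>\<^sub>F x in F. inj_on (\<lambda>a. v a x) A \<and> independent ((\<lambda>a. v a x) ` A)"
proof -
  obtain w where w: "\<And>a b. a \<in> A \<Longrightarrow> b \<in> A \<Longrightarrow> u a \<bullet> w b = (if a = b then 1 else 0)"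
    using dual_family[OF ind inj] by blast
  define T where "T x h = h + (\<Sum>b\<in>A. (h \<bullet> w b) *\<^sub>R (v b x - u b))" for x h
  have "((\<lambda>x. \<Sum>b\<in>A. norm (w b) * norm (v b x - u b)) \<longlongrightarrow> (\<Sum>b\<in>A. norm (w b) * norm (u b - u b))) F"
    by (intro tendsto_intros lim)
  then have "\<forall>\<^sub>F x in F. (\<Sum>b\<in>A. norm (w b) * norm (v b x - u b)) < 1 / 2"
    by (rule order_tendstoD) simp
  then show ?thesis
  proof (rule eventually_mono)
    fix x
    assume small: "(\<Sum>b\<in>A. norm (w b) * norm (v b x - u b)) < 1 / 2"
    have lin: "linear (T x)"
      unfolding T_def
      by (rule linearI) (simp_all add: inner_add_left scaleR_add_left sum.distrib
          scaleR_add_right scaleR_sum_right)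
    have "norm h \<le> 2 * norm (T x h)" for h
    proof (rule near_identity_bound)
      have "norm (T x h - h) \<le> (\<Sum>b\<in>A. norm ((h \<bullet> w b) *\<^sub>R (v b x - u b)))"
        unfolding T_def add_diff_cancel_left' by (rule norm_sum)
      also have "\<dots> \<le> (\<Sum>b\<in>A. norm h * (norm (w b) * norm (v b x - u b)))"
      proof (rule sum_mono)
        fix b
        show "norm ((h \<bullet> w b) *\<^sub>R (v b x - u b)) \<le> norm h * (norm (w b) * norm (v b x - u b))"
          using mult_right_mono[OF Cauchy_Schwarz_ineq2[of h "w b"] norm_ge_zero[of "v b x - u b"]]
          by (simp add: mult.assoc)
      qed
      also have "\<dots> = norm h * (\<Sum>b\<in>A. norm (w b) * norm (v b x - u b))"
        by (simp add: sum_distrib_left)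
      also have "\<dots> \<le> norm h * (1 / 2)"
        using small by (intro mult_left_mono) auto
      finally show "norm (T x h - h) \<le> norm h / 2" by simp
    qed
    then have injT: "inj (T x)"
      unfolding linear_injective_0[OF lin] by (metis mult_zero_right norm_le_zero_iff norm_zero)
    have Tu: "T x (u a) = v a x" if "a \<in> A" for a
    proof -
      have "(\<Sum>b\<in>A. (u a \<bullet> w b) *\<^sub>R (v b x - u b)) = (\<Sum>b\<in>A. if a = b then v b x - u b else 0)"
        using w that by (intro sum.cong) auto
      then show ?thesis
        using fin that by (simp add: T_def)
    qed
    have "inj_on (T x \<circ> u) A"
      using inj injT by (intro comp_inj_on) (auto intro: inj_on_subset)
    then have "inj_on (\<lambda>a. v a x) A"
      using Tu by (simp add: inj_on_def)
    moreover have "independent (T x ` u ` A)"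
      using ind injT lin by (intro linear_independent_injective_image) (auto intro: inj_on_subset)
    moreover have "T x ` u ` A = (\<lambda>a. v a x) ` A"
      using Tu by (auto simp: image_image)
    ultimately show "inj_on (\<lambda>a. v a x) A \<and> independent ((\<lambda>a. v a x) ` A)"
      by simp
  qed
qed

section \<open>Arcs in level sets\<close>

text \<open>Differentiating \<open>L(s) \<eta>(s) = b\<close> formally forces \<open>L(t) \<eta>' = - p'\<close>, where \<open>p'\<close> is the derivative at \<open>t\<close> of
  \<open>s \<mapsto> L(s) \<eta>(t)\<close>. With \<open>\<eta>'\<close> chosen in this way, \<open>L(s)\<close> maps the first-order error
  \<open>\<eta>(s) - \<eta>(t) - (s - t) \<eta>'\<close> to the increment \<open>r(t) - r(s)\<close> of the curve
  \<open>r(s) = L(s) \<eta>(t) + (s - t) L(s) \<eta>'\<close>, whose derivative at \<open>t\<close> vanishes. The uniform lower bound on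
  \<open>L(s)\<close> turns this into \<open>o(s - t)\<close> for the error itself.\<close>

lemma linear_solution_has_vector_derivative:
  fixes L :: "real \<Rightarrow> 'a::real_normed_vector \<Rightarrow> 'b::real_normed_vector"
  assumes lin: "\<And>s. s \<in> S \<Longrightarrow> linear (L s)"
    and bound: "\<And>s h. s \<in> S \<Longrightarrow> norm h \<le> c * norm (L s h)"
    and diff: "\<And>h. (\<lambda>s. L s h) differentiable (at t within S)"
    and surj: "surj (L t)"
    and "t \<in> S"
    and sol: "\<And>s. s \<in> S \<Longrightarrow> L s (\<eta> s) = b"
  shows "\<exists>\<eta>'. (\<eta> has_vector_derivative \<eta>') (at t within S)"
proof -
  obtain p' where p': "((\<lambda>s. L s (\<eta> t)) has_vector_derivative p') (at t within S)"
    using diff[of "\<eta> t"] vector_derivative_works by blast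
  obtain \<eta>' where \<eta>': "L t \<eta>' = - p'"
    using surj by (metis surj_def)
  obtain q' where q': "((\<lambda>s. L s \<eta>') has_vector_derivative q') (at t within S)"
    using diff[of \<eta>'] vector_derivative_works by blast
  define r where "r s = L s (\<eta> t) + (s - t) *\<^sub>R L s \<eta>'" for s
  have "(r has_vector_derivative p' + ((t - t) *\<^sub>R q' + 1 *\<^sub>R L t \<eta>')) (at t within S)"
    unfolding r_def
    by (intro has_vector_derivative_add p' has_vector_derivative_scaleR q')
       (auto intro!: derivative_eq_intros)
  then have "(r has_vector_derivative 0) (at t within S)"
    using \<eta>' by simp
  then have "((\<lambda>s. (1 / norm (s - t)) *\<^sub>R (r s - r t)) \<longlongrightarrow> 0) (at t within S)"
    by (simp add: has_vector_derivative_def has_derivative_within)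
  then have lim: "((\<lambda>s. c * norm ((1 / norm (s - t)) *\<^sub>R (r s - r t))) \<longlongrightarrow> 0) (at t within S)"
    by (intro tendsto_mult_right_zero tendsto_norm_zero)
  have "((\<lambda>s. (1 / norm (s - t)) *\<^sub>R (\<eta> s - (\<eta> t + (s - t) *\<^sub>R \<eta>'))) \<longlongrightarrow> 0) (at t within S)"
  proof (rule Lim_null_comparison[OF _ lim])
    have "norm ((1 / norm (s - t)) *\<^sub>R (\<eta> s - (\<eta> t + (s - t) *\<^sub>R \<eta>')))
        \<le> c * norm ((1 / norm (s - t)) *\<^sub>R (r s - r t))" if "s \<in> S" for s
    proof -
      interpret Ls: linear "L s" using lin[OF that] .
      have "L s ((1 / norm (s - t)) *\<^sub>R (\<eta> s - (\<eta> t + (s - t) *\<^sub>R \<eta>')))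
          = - ((1 / norm (s - t)) *\<^sub>R (r s - r t))"
        using sol[OF that] sol[OF \<open>t \<in> S\<close>]
        by (simp add: Ls.scaleR Ls.diff Ls.add r_def flip: scaleR_minus_right)
      then show ?thesis
        using bound[OF that] by (metis norm_minus_cancel)
    qed
    then show "\<forall>\<^sub>F s in at t within S. norm ((1 / norm (s - t)) *\<^sub>R (\<eta> s - (\<eta> t + (s - t) *\<^sub>R \<eta>')))
        \<le> c * norm ((1 / norm (s - t)) *\<^sub>R (r s - r t))"
      by (auto simp: eventually_at_filter)
  qed
  then have "(\<eta> has_vector_derivative \<eta>') (at t within S)"
    by (simp add: has_vector_derivative_def has_derivative_within bounded_linear_scaleR_left)
  then show ?thesis by blast
qed

text \<open>Let \<open>w\<close> be dual to the gradients at \<open>x0\<close>. The map \<open>F\<close> below replaces, in \<open>x - x0\<close>, each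
  coordinate \<open>(x - x0) \<bullet> \<nabla>\<phi>(x0)\<close> by \<open>\<phi>(x)\<close> itself. These agree to first order, so the derivative of \<open>F\<close>
  at \<open>x0\<close> is the identity; and \<open>\<nabla>\<phi>(x0) \<bullet> F(x) = \<phi>(x)\<close>, so \<open>F\<close> maps a point onto the line spanned by
  the tangent direction \<open>d\<close> only if every \<open>\<phi>\<close> vanishes there. The arc is the preimage of that line.\<close>

lemma independent_level_set_arc:
  fixes A :: "('a::euclidean_space \<Rightarrow> real) set"
  assumes fin: "finite A"
    and C2: "\<And>\<phi>. \<phi> \<in> A \<Longrightarrow> twice_continuously_differentiable \<phi>"
    and inj: "inj_on (\<lambda>\<phi>. gradient \<phi> x0) A"
    and ind: "independent ((\<lambda>\<phi>. gradient \<phi> x0) ` A)"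
    and zero: "\<forall>\<phi>\<in>A. \<phi> x0 = 0"
    and tangent: "\<And>\<phi>. \<phi> \<in> A \<Longrightarrow> gradient \<phi> x0 \<bullet> d = 0"
  obtains \<delta> \<zeta> \<zeta>' \<zeta>'' where "\<delta> > 0" "\<zeta> 0 = x0" "\<zeta>' 0 = d"
    "\<And>t. \<bar>t\<bar> < \<delta> \<Longrightarrow> (\<zeta> has_vector_derivative \<zeta>' t) (at t)"
    "\<And>t. \<bar>t\<bar> < \<delta> \<Longrightarrow> (\<zeta>' has_vector_derivative \<zeta>'' t) (at t)"
    "\<And>t \<phi>. \<bar>t\<bar> < \<delta> \<Longrightarrow> \<phi> \<in> A \<Longrightarrow> \<phi> (\<zeta> t) = 0"
proof -
  define v where "v \<phi> = gradient \<phi> x0" for \<phi> :: "'a \<Rightarrow> real"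
  obtain w where w: "\<And>\<phi> \<psi>. \<phi> \<in> A \<Longrightarrow> \<psi> \<in> A \<Longrightarrow> v \<phi> \<bullet> w \<psi> = (if \<phi> = \<psi> then 1 else 0)"
    using dual_family[OF ind inj] unfolding v_def by blast
  define F where "F x = (x - x0) + (\<Sum>\<phi>\<in>A. (\<phi> x - (x - x0) \<bullet> v \<phi>) *\<^sub>R w \<phi>)" for x
  define L where "L x = id_blinfun + (\<Sum>\<phi>\<in>A. blinfun_scaleR_left (w \<phi>) o\<^sub>L
      blinfun_inner_left (gradient \<phi> x - v \<phi>))" for x
  have L_apply: "blinfun_apply (L x) h = h + (\<Sum>\<phi>\<in>A. (h \<bullet> (gradient \<phi> x - v \<phi>)) *\<^sub>R w \<phi>)" for x h
    by (simp add: L_def plus_blinfun.rep_eq blinfun.sum_left)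
  have contL: "continuous_on X L" for X
    unfolding L_def
    by (intro continuous_intros bounded_linear.continuous_on[OF bounded_linear_blinfun_inner_left]
        continuous_at_imp_continuous_on ballI C2_gradient_isCont C2)
  have derF: "(F has_derivative blinfun_apply (L x)) (at x)" for x
  proof -
    have "(F has_derivative (\<lambda>h. (h - 0) + (\<Sum>\<phi>\<in>A. (h \<bullet> gradient \<phi> x - (h - 0) \<bullet> v \<phi>) *\<^sub>R w \<phi>))) (at x)"
      unfolding F_def
      by (intro has_derivative_add has_derivative_diff has_derivative_sum has_derivative_scaleR_left
          has_derivative_inner_left has_derivative_ident has_derivative_const C2_has_derivative C2)
    then show ?thesis
      by (simp add: L_apply[abs_def] inner_diff_right)
  qed
  have Lx0: "L x0 = id_blinfun"
    by (rule blinfun_eqI) (simp add: L_apply v_def)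
  then have inv: "id_blinfun o\<^sub>L L x0 = id_blinfun"
    by (intro blinfun_eqI) simp
  have Fx0: "F x0 = 0"
    by (simp add: F_def zero)
  \<comment> \<open>On \<open>U\<close> the derivative is bounded below uniformly, as is needed to differentiate the velocity.\<close>
  define U where "U = {x. norm (L x - id_blinfun) < 1 / 2}"
  have "open U"
    unfolding U_def by (intro open_Collect_less continuous_intros contL)
  have "x0 \<in> U"
    by (simp add: U_def Lx0)
  have bound: "norm h \<le> 2 * norm (L x h)" if "x \<in> U" for x h
  proof (rule near_identity_bound)
    have "norm (L x h - h) = norm ((L x - id_blinfun) h)"
      by (simp add: minus_blinfun.rep_eq)
    also have "\<dots> \<le> norm (L x - id_blinfun) * norm h"
      by (rule norm_blinfun)
    also have "\<dots> \<le> 1 / 2 * norm h"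
      using that by (intro mult_right_mono) (auto simp: U_def)
    finally show "norm (L x h - h) \<le> norm h / 2" by simp
  qed
  obtain U' V g g' where "U' \<subseteq> U" "x0 \<in> U'" "open V" "F x0 \<in> V"
    and hom: "homeomorphism U' V F g"
    and derg: "\<And>y. y \<in> V \<Longrightarrow> (g has_derivative g' y) (at y)"
    and g': "\<And>y. y \<in> V \<Longrightarrow> g' y = inv (blinfun_apply (L (g y)))"
    and bij: "\<And>y. y \<in> V \<Longrightarrow> bij (blinfun_apply (L (g y)))"
    using inverse_function_theorem[OF \<open>open U\<close> derF contL \<open>x0 \<in> U\<close> inv] by metis
  obtain e where "e > 0" and e: "ball 0 e \<subseteq> V"
    using \<open>open V\<close> \<open>F x0 \<in> V\<close> Fx0 open_contains_ball by metis
  \<comment> \<open>The summand \<open>1\<close> keeps the denominator positive when \<open>d = 0\<close>.\<close>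
  define \<delta> where "\<delta> = e / (norm d + 1)"
  have pos: "0 < norm d + 1"
    using norm_ge_zero[of d] by linarith
  have "\<delta> > 0"
    using \<open>e > 0\<close> pos by (simp add: \<delta>_def)
  have inV: "t *\<^sub>R d \<in> V" if "\<bar>t\<bar> < \<delta>" for t
  proof -
    have "norm (t *\<^sub>R d) \<le> \<bar>t\<bar> * (norm d + 1)"
      by (simp add: mult_left_mono)
    also have "\<dots> < e"
      using that pos by (simp add: \<delta>_def pos_less_divide_eq)
    finally show ?thesis
      using e by (auto simp: subset_iff)
  qed
  define \<zeta> where "\<zeta> t = g (t *\<^sub>R d)" for t
  define \<zeta>' where "\<zeta>' t = g' (t *\<^sub>R d) d" for t
  have F\<zeta>: "F (\<zeta> t) = t *\<^sub>R d" if "\<bar>t\<bar> < \<delta>" for t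
    using hom inV[OF that] unfolding \<zeta>_def by (rule homeomorphism_apply2)
  have \<zeta>U: "\<zeta> t \<in> U" if "\<bar>t\<bar> < \<delta>" for t
    using homeomorphism_image2[OF hom] inV[OF that] \<open>U' \<subseteq> U\<close> unfolding \<zeta>_def by blast
  have \<zeta>0: "\<zeta> 0 = x0"
    using homeomorphism_apply1[OF hom \<open>x0 \<in> U'\<close>] by (simp add: \<zeta>_def Fx0)
  have L\<zeta>': "L (\<zeta> t) (\<zeta>' t) = d" if "\<bar>t\<bar> < \<delta>" for t
    unfolding \<zeta>_def \<zeta>'_def g'[OF inV[OF that]]
    by (rule surj_f_inv_f[OF bij_is_surj[OF bij[OF inV[OF that]]]])
  have \<zeta>'0: "\<zeta>' 0 = d"
    using L\<zeta>'[of 0] \<open>\<delta> > 0\<close> by (simp add: \<zeta>0 Lx0)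
  have der\<zeta>: "(\<zeta> has_vector_derivative \<zeta>' t) (at t)" if "\<bar>t\<bar> < \<delta>" for t
  proof -
    have lin: "linear (g' (t *\<^sub>R d))"
      using derg[OF inV[OF that]] by (rule has_derivative_linear)
    have "((\<lambda>s. s *\<^sub>R d) has_derivative (\<lambda>s. s *\<^sub>R d)) (at t)"
      by (auto intro!: derivative_eq_intros)
    from has_derivative_compose[OF this derg[OF inV[OF that]]]
    show ?thesis
      by (simp add: has_vector_derivative_def \<zeta>_def[abs_def] \<zeta>'_def linear_scale[OF lin])
  qed
  define S where "S = {-\<delta><..<\<delta>}"
  have S: "s \<in> S \<longleftrightarrow> \<bar>s\<bar> < \<delta>" for s
    by (auto simp: S_def)
  have "\<exists>\<eta>'. (\<zeta>' has_vector_derivative \<eta>') (at t)" if t: "\<bar>t\<bar> < \<delta>" for t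
  proof -
    have "\<exists>\<eta>'. (\<zeta>' has_vector_derivative \<eta>') (at t within S)"
    proof (rule linear_solution_has_vector_derivative)
      show "linear (blinfun_apply (L (\<zeta> s)))" for s
        by (rule bounded_linear.linear) (rule blinfun.bounded_linear_right)
      show "norm h \<le> 2 * norm (L (\<zeta> s) h)" if "s \<in> S" for s h
        using bound \<zeta>U that S by blast
      show "(\<lambda>s. blinfun_apply (L (\<zeta> s)) h) differentiable at t within S" for h
      proof -
        have "(\<lambda>s. gradient \<phi> (\<zeta> s)) differentiable at t within S" if "\<phi> \<in> A" for \<phi>
        proof (rule differentiable_compose[of "gradient \<phi>" \<zeta>])
          show "gradient \<phi> differentiable at (\<zeta> t)"
            using that by (intro C2_gradient_differentiable C2)
          show "\<zeta> differentiable at t within S"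
            using der\<zeta>[OF t] differentiableI_vector differentiable_at_withinI by blast
        qed
        then show ?thesis
          unfolding L_apply
          by (intro differentiable_add differentiable_const differentiable_sum fin ballI
              differentiable_scaleR differentiable_inner differentiable_diff)
      qed
      show "surj (blinfun_apply (L (\<zeta> t)))"
        unfolding \<zeta>_def by (intro bij_is_surj bij inV t)
      show "t \<in> S" using t S by blast
      show "L (\<zeta> s) (\<zeta>' s) = d" if "s \<in> S" for s
        using L\<zeta>' that S by blast
    qed
    moreover have "at t within S = at t"
      using t S by (intro at_within_open) (auto simp: S_def)
    ultimately show ?thesis by simp
  qed
  then obtain \<zeta>'' where \<zeta>'': "\<And>t. \<bar>t\<bar> < \<delta> \<Longrightarrow> (\<zeta>' has_vector_derivative \<zeta>'' t) (at t)"
    by metis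
  have "\<psi> (\<zeta> t) = 0" if t: "\<bar>t\<bar> < \<delta>" and "\<psi> \<in> A" for t \<psi>
  proof -
    have "(\<Sum>\<phi>\<in>A. (\<phi> (\<zeta> t) - (\<zeta> t - x0) \<bullet> v \<phi>) * (v \<psi> \<bullet> w \<phi>))
        = (\<Sum>\<phi>\<in>A. if \<psi> = \<phi> then \<phi> (\<zeta> t) - (\<zeta> t - x0) \<bullet> v \<phi> else 0)"
      using w \<open>\<psi> \<in> A\<close> by (intro sum.cong) auto
    also have "\<dots> = \<psi> (\<zeta> t) - (\<zeta> t - x0) \<bullet> v \<psi>"
      using fin \<open>\<psi> \<in> A\<close> by simp
    finally have "v \<psi> \<bullet> F (\<zeta> t) = v \<psi> \<bullet> (\<zeta> t - x0) + (\<psi> (\<zeta> t) - (\<zeta> t - x0) \<bullet> v \<psi>)"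
      by (simp add: F_def inner_add_right inner_sum_right)
    then have "\<psi> (\<zeta> t) = v \<psi> \<bullet> F (\<zeta> t)"
      by (simp add: inner_commute)
    also have "\<dots> = 0"
      using tangent[OF \<open>\<psi> \<in> A\<close>] by (simp add: F\<zeta>[OF t] v_def)
    finally show ?thesis .
  qed
  then show thesis
    by (intro that[of \<delta> \<zeta> \<zeta>' \<zeta>''] \<open>\<delta> > 0\<close> \<zeta>0 \<zeta>'0 der\<zeta> \<zeta>'')
qed

text \<open>An arc that satisfies a maximal independent part \<open>A\<close> of the equations satisfies all of them: its
  velocity is orthogonal to the gradients from \<open>A\<close>, which by constancy of the rank span all gradients
  along the arc, so each function of \<open>\<Phi>\<close> has derivative \<open>0\<close> along it.\<close>

lemma constant_rank_level_set_arc: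
  fixes \<Phi> :: "('a::euclidean_space \<Rightarrow> real) set"
  assumes fin: "finite \<Phi>"
    and C2: "\<And>\<phi>. \<phi> \<in> \<Phi> \<Longrightarrow> twice_continuously_differentiable \<phi>"
    and rank: "\<forall>\<^sub>F x in nhds x0. dim ((\<lambda>\<phi>. gradient \<phi> x) ` \<Phi>) = r"
    and zero: "\<forall>\<phi>\<in>\<Phi>. \<phi> x0 = 0"
    and tangent: "\<And>\<phi>. \<phi> \<in> \<Phi> \<Longrightarrow> gradient \<phi> x0 \<bullet> d = 0"
  obtains \<delta> \<zeta> \<zeta>' \<zeta>'' where "\<delta> > 0" "\<zeta> 0 = x0" "\<zeta>' 0 = d"
    "\<And>t. \<bar>t\<bar> < \<delta> \<Longrightarrow> (\<zeta> has_vector_derivative \<zeta>' t) (at t)"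
    "\<And>t. \<bar>t\<bar> < \<delta> \<Longrightarrow> (\<zeta>' has_vector_derivative \<zeta>'' t) (at t)"
    "\<And>t \<phi>. \<bar>t\<bar> < \<delta> \<Longrightarrow> \<phi> \<in> \<Phi> \<Longrightarrow> \<phi> (\<zeta> t) = 0"
proof -
  obtain B where B: "B \<subseteq> (\<lambda>\<phi>. gradient \<phi> x0) ` \<Phi>" "independent B"
    "(\<lambda>\<phi>. gradient \<phi> x0) ` \<Phi> \<subseteq> span B" "card B = dim ((\<lambda>\<phi>. gradient \<phi> x0) ` \<Phi>)"
    using basis_exists by blast
  then obtain A where "A \<subseteq> \<Phi>" and inj: "inj_on (\<lambda>\<phi>. gradient \<phi> x0) A"
    and BA: "B = (\<lambda>\<phi>. gradient \<phi> x0) ` A"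
    by (metis subset_image_inj)
  have ind: "independent ((\<lambda>\<phi>. gradient \<phi> x0) ` A)"
    using B BA by simp
  have finA: "finite A"
    using \<open>A \<subseteq> \<Phi>\<close> fin finite_subset by blast
  have cardA: "card A = r"
    using eventually_nhds_x_imp_x[OF rank] B(4) card_image[OF inj] BA by simp
  have "\<forall>\<^sub>F x in nhds x0. inj_on (\<lambda>\<phi>. gradient \<phi> x) A \<and> independent ((\<lambda>\<phi>. gradient \<phi> x) ` A)"
    using C2_gradient_isCont C2 \<open>A \<subseteq> \<Phi>\<close>
    by (intro eventually_independent_family[OF finA ind inj])
       (auto simp: isCont_def tendsto_at_iff_tendsto_nhds)
  with rank have "\<forall>\<^sub>F x in nhds x0.
      (\<lambda>\<phi>. gradient \<phi> x) ` \<Phi> \<subseteq> span ((\<lambda>\<phi>. gradient \<phi> x) ` A)"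
  proof eventually_elim
    case (elim x)
    then show ?case
      using \<open>A \<subseteq> \<Phi>\<close> cardA by (intro card_ge_dim_independent) (auto simp: card_image)
  qed
  then obtain N where "open N" "x0 \<in> N"
    and spanN: "\<And>x. x \<in> N \<Longrightarrow> (\<lambda>\<phi>. gradient \<phi> x) ` \<Phi> \<subseteq> span ((\<lambda>\<phi>. gradient \<phi> x) ` A)"
    unfolding eventually_nhds by blast
  obtain \<delta> \<zeta> \<zeta>' \<zeta>'' where "\<delta> > 0" and \<zeta>0: "\<zeta> 0 = x0" and \<zeta>'0: "\<zeta>' 0 = d"
    and \<zeta>': "\<And>t. \<bar>t\<bar> < \<delta> \<Longrightarrow> (\<zeta> has_vector_derivative \<zeta>' t) (at t)"
    and \<zeta>'': "\<And>t. \<bar>t\<bar> < \<delta> \<Longrightarrow> (\<zeta>' has_vector_derivative \<zeta>'' t) (at t)"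
    and A0: "\<And>t \<phi>. \<bar>t\<bar> < \<delta> \<Longrightarrow> \<phi> \<in> A \<Longrightarrow> \<phi> (\<zeta> t) = 0"
    using independent_level_set_arc[OF finA _ inj ind, of d] C2 zero tangent \<open>A \<subseteq> \<Phi>\<close>
    by (smt (verit, best) subsetD)
  have "isCont \<zeta> 0"
    using \<zeta>'[of 0] \<open>\<delta> > 0\<close> has_vector_derivative_continuous by auto
  then have "\<forall>\<^sub>F t in nhds 0. \<zeta> t \<in> N"
    using \<open>open N\<close> \<open>x0 \<in> N\<close> \<zeta>0
    by (metis isCont_def tendsto_at_iff_tendsto_nhds topological_tendstoD)
  then obtain \<gamma> where "\<gamma> > 0" and \<gamma>: "\<And>t. \<bar>t\<bar> < \<gamma> \<Longrightarrow> \<zeta> t \<in> N"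
    unfolding eventually_nhds_metric by auto
  define \<mu> where "\<mu> = min \<delta> \<gamma>"
  have "\<mu> > 0" using \<open>\<delta> > 0\<close> \<open>\<gamma> > 0\<close> by (simp add: \<mu>_def)
  define S where "S = {-\<mu><..<\<mu>}"
  have S: "s \<in> S \<longleftrightarrow> \<bar>s\<bar> < \<mu>" for s
    by (auto simp: S_def)
  have "\<phi> (\<zeta> t) = 0" if t: "\<bar>t\<bar> < \<mu>" and "\<phi> \<in> \<Phi>" for t \<phi>
  proof -
    have orth: "\<zeta>' s \<bullet> gradient \<phi> (\<zeta> s) = 0" if s: "\<bar>s\<bar> < \<mu>" for s
    proof -
      have "orthogonal (\<zeta>' s) (gradient \<psi> (\<zeta> s))" if "\<psi> \<in> A" for \<psi>
      proof -
        have "((\<lambda>s. \<psi> (\<zeta> s)) has_vector_derivative (\<zeta>' s \<bullet> gradient \<psi> (\<zeta> s))) (at s)"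
          using that s \<open>A \<subseteq> \<Phi>\<close> by (intro C2_compose_vector_derivative C2 \<zeta>') (auto simp: \<mu>_def)
        moreover have "((\<lambda>s. \<psi> (\<zeta> s)) has_vector_derivative 0) (at s)"
        proof (rule has_vector_derivative_transform_within_open)
          show "((\<lambda>s. 0) has_vector_derivative 0) (at s)" by simp
          show "open S" "s \<in> S" using s by (auto simp: S_def)
          show "0 = \<psi> (\<zeta> s)" if "s \<in> S" for s
            using A0 \<open>\<psi> \<in> A\<close> that S by (simp add: \<mu>_def)
        qed
        ultimately show ?thesis
          using vector_derivative_unique_at unfolding orthogonal_def by blast
      qed
      moreover have "gradient \<phi> (\<zeta> s) \<in> span ((\<lambda>\<psi>. gradient \<psi> (\<zeta> s)) ` A)"
        using spanN[OF \<gamma>] s \<open>\<phi> \<in> \<Phi>\<close> by (auto simp: \<mu>_def)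
      ultimately have "orthogonal (\<zeta>' s) (gradient \<phi> (\<zeta> s))"
        using orthogonal_to_span[of "gradient \<phi> (\<zeta> s)" "(\<lambda>\<psi>. gradient \<psi> (\<zeta> s)) ` A" "\<zeta>' s"]
        by blast
      then show ?thesis
        by (simp add: orthogonal_def)
    qed
    have "((\<lambda>s. \<phi> (\<zeta> s)) has_vector_derivative 0) (at s within S)" if "s \<in> S" for s
      using C2_compose_vector_derivative[OF C2[OF \<open>\<phi> \<in> \<Phi>\<close>] \<zeta>'[of s]] that S orth[of s]
      by (auto simp: \<mu>_def intro: has_vector_derivative_at_within)
    then obtain c where c: "\<And>s. s \<in> S \<Longrightarrow> \<phi> (\<zeta> s) = c"
      by (rule has_vector_derivative_zero_constant[rotated]) (auto simp: S_def)
    have "\<phi> (\<zeta> t) = \<phi> (\<zeta> 0)"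
      using c[of t] c[of 0] t \<open>\<mu> > 0\<close> S by simp
    then show ?thesis
      using \<zeta>0 zero \<open>\<phi> \<in> \<Phi>\<close> by simp
  qed
  then show thesis
    using \<zeta>' \<zeta>'' by (intro that[of \<mu> \<zeta> \<zeta>' \<zeta>''] \<open>\<mu> > 0\<close> \<zeta>0 \<zeta>'0) (auto simp: \<mu>_def)
qed

section \<open>The second-order constraint qualification\<close>

text \<open>A set of functions rather than an indexed family suffices, since the rank of the gradients
  depends only on the set of gradients.\<close>

definition active_functions :: "('n::finite) mpsc \<Rightarrow> real ^ 'n \<Rightarrow> (real ^ 'n \<Rightarrow> real) set" where
  "active_functions P xbar =
    con_g P ` idx_g P xbar \<union> con_h P ` idx_h P \<union>
    sw_G P ` (idx_G P xbar \<union> idx_GH P xbar) \<union>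
    sw_H P ` (idx_H P xbar \<union> idx_GH P xbar)"

lemmas idx_defs = idx_g_def idx_h_def idx_G_def idx_H_def idx_GH_def

lemma active_gradients_eq_image:
  "active_gradients P xbar x = (\<lambda>\<phi>. gradient \<phi> x) ` active_functions P xbar"
  by (simp add: active_gradients_def active_functions_def image_Un image_image)

theorem lemma3p5:
  fixes P :: "('n::finite) mpsc" and xbar :: "real ^ 'n"
  assumes "mpsc_C2 P"
    and "xbar \<in> feasible_set P"
    and "MPSC_WCR P xbar"
  shows "MPSC_WSOCQ P xbar"
  unfolding MPSC_WSOCQ_def
proof (intro ballI impI)
  fix d
  assume d: "d \<in> critical_subspace P xbar"
  let ?\<Phi> = "active_functions P xbar"
  have fin: "finite ?\<Phi>"
    by (simp add: active_functions_def idx_defs)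
  have C2: "twice_continuously_differentiable \<phi>" if "\<phi> \<in> ?\<Phi>" for \<phi>
    using that assms(1) by (auto simp: active_functions_def idx_defs mpsc_C2_def)
  have zero: "\<forall>\<phi>\<in>?\<Phi>. \<phi> xbar = 0"
    using assms(2) by (auto simp: active_functions_def idx_defs feasible_set_def)
  have tangent: "gradient \<phi> xbar \<bullet> d = 0" if "\<phi> \<in> ?\<Phi>" for \<phi>
    using that d by (auto simp: active_functions_def critical_subspace_def)
  obtain r where rank: "\<forall>\<^sub>F x in nhds xbar. dim ((\<lambda>\<phi>. gradient \<phi> x) ` ?\<Phi>) = r"
    using assms(3) unfolding MPSC_WCR_def active_gradients_eq_image eventually_nhds_metric dist_norm
    by blast
  obtain \<delta> \<zeta> \<zeta>' \<zeta>'' where "\<delta> > 0" and \<zeta>0: "\<zeta> 0 = xbar" and \<zeta>'0: "\<zeta>' 0 = d"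
    and \<zeta>': "\<And>t. \<bar>t\<bar> < \<delta> \<Longrightarrow> (\<zeta> has_vector_derivative \<zeta>' t) (at t)"
    and \<zeta>'': "\<And>t. \<bar>t\<bar> < \<delta> \<Longrightarrow> (\<zeta>' has_vector_derivative \<zeta>'' t) (at t)"
    and active: "\<And>t \<phi>. \<bar>t\<bar> < \<delta> \<Longrightarrow> \<phi> \<in> ?\<Phi> \<Longrightarrow> \<phi> (\<zeta> t) = 0"
    using constant_rank_level_set_arc[OF fin C2 rank zero tangent] by blast
  have "isCont \<zeta> 0"
    using \<zeta>'[of 0] \<open>\<delta> > 0\<close> has_vector_derivative_continuous by auto
  have "\<forall>\<^sub>F t in nhds 0. con_g P i (\<zeta> t) < 0"
    if "i \<in> {1..num_g P} - idx_g P xbar" for i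
  proof -
    have "isCont (con_g P i) (\<zeta> 0)"
      using assms(1) that by (intro C2_isCont) (auto simp: mpsc_C2_def)
    then have "isCont (\<lambda>t. con_g P i (\<zeta> t)) 0"
      by (rule isCont_o2[OF \<open>isCont \<zeta> 0\<close>])
    then have "((\<lambda>t. con_g P i (\<zeta> t)) \<longlongrightarrow> con_g P i xbar) (nhds 0)"
      using tendsto_at_iff_tendsto_nhds[of "\<lambda>t. con_g P i (\<zeta> t)" 0] by (simp add: isCont_def \<zeta>0)
    moreover have "con_g P i xbar < 0"
      using assms(2) that by (auto simp: feasible_set_def idx_defs order.strict_iff_order)
    ultimately show ?thesis
      by (rule order_tendstoD)
  qed
  then have "\<forall>\<^sub>F t in nhds 0. \<forall>i\<in>{1..num_g P} - idx_g P xbar. con_g P i (\<zeta> t) < 0"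
    by (simp add: eventually_ball_finite)
  then obtain \<gamma> where "\<gamma> > 0"
    and \<gamma>: "\<And>t i. \<bar>t\<bar> < \<gamma> \<Longrightarrow> i \<in> {1..num_g P} - idx_g P xbar \<Longrightarrow> con_g P i (\<zeta> t) < 0"
    unfolding eventually_nhds_metric by auto
  define \<mu> where "\<mu> = min \<delta> \<gamma>"
  have "\<mu> > 0" using \<open>\<delta> > 0\<close> \<open>\<gamma> > 0\<close> by (simp add: \<mu>_def)
  have small: "\<bar>t\<bar> < \<delta>" "\<bar>t\<bar> < \<gamma>" if "t \<in> {0..<\<mu>}" for t
    using that by (auto simp: \<mu>_def)
  have g0: "con_g P i (\<zeta> t) = 0" if "t \<in> {0..<\<mu>}" "i \<in> idx_g P xbar" for t i
    using active small that by (auto simp: active_functions_def)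
  have h0: "con_h P j (\<zeta> t) = 0" if "t \<in> {0..<\<mu>}" "j \<in> idx_h P" for t j
    using active small that by (auto simp: active_functions_def)
  have G0: "sw_G P k (\<zeta> t) = 0" if "t \<in> {0..<\<mu>}" "k \<in> idx_G P xbar \<union> idx_GH P xbar" for t k
    using active[OF small(1)[OF that(1)], of "sw_G P k"] that(2)
    unfolding active_functions_def by blast
  have H0: "sw_H P k (\<zeta> t) = 0" if "t \<in> {0..<\<mu>}" "k \<in> idx_H P xbar \<union> idx_GH P xbar" for t k
    using active[OF small(1)[OF that(1)], of "sw_H P k"] that(2)
    unfolding active_functions_def by blast
  \<comment> \<open>At the feasible point one factor of each product vanishes; being active, it stays zero along the arc.\<close>
  have cover: "k \<in> (idx_G P xbar \<union> idx_GH P xbar) \<union> (idx_H P xbar \<union> idx_GH P xbar)"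
    if "k \<in> {1..num_sw P}" for k
    using that assms(2) by (auto simp: feasible_set_def idx_defs)
  have feasible: "\<zeta> t \<in> feasible_set P" if "t \<in> {0..<\<mu>}" for t
    unfolding feasible_set_def
  proof (intro CollectI conjI ballI)
    show "con_g P i (\<zeta> t) \<le> 0" if "i \<in> {1..num_g P}" for i
      using g0[of t i] \<gamma>[of t i] small \<open>t \<in> {0..<\<mu>}\<close> that by (cases "i \<in> idx_g P xbar") force+
    show "con_h P j (\<zeta> t) = 0" if "j \<in> {1..num_h P}" for j
      using h0 \<open>t \<in> {0..<\<mu>}\<close> that by (simp add: idx_h_def)
    show "sw_G P k (\<zeta> t) * sw_H P k (\<zeta> t) = 0" if "k \<in> {1..num_sw P}" for k
      using G0 H0 \<open>t \<in> {0..<\<mu>}\<close> cover[OF that] by auto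
  qed
  have arc: "twice_differentiable_arc_on \<zeta> {0..<\<mu>}"
    unfolding twice_differentiable_arc_on_def
    using \<zeta>' \<zeta>'' small has_vector_derivative_at_within by blast
  have "(\<zeta> has_vector_derivative d) (at_right 0)"
    using \<zeta>'[of 0] \<open>\<delta> > 0\<close> \<zeta>'0 has_vector_derivative_at_within by auto
  with \<open>\<mu> > 0\<close> arc feasible \<zeta>0 g0 G0 H0
  show "\<exists>\<delta>>0. \<exists>J K. \<exists>\<zeta> :: real \<Rightarrow> real ^ 'n.
         J \<subseteq> idx_GH P xbar \<and> K \<subseteq> idx_GH P xbar \<and>
         twice_differentiable_arc_on \<zeta> {0..<\<delta>} \<and>
         (\<forall>t\<in>{0..<\<delta>}. \<zeta> t \<in> feasible_set P) \<and>
         \<zeta> 0 = xbar \<and>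
         (\<zeta> has_vector_derivative d) (at_right 0) \<and>
         (\<forall>t\<in>{0..<\<delta>}.
            (\<forall>i\<in>idx_g P xbar. con_g P i (\<zeta> t) = 0) \<and>
            (\<forall>k\<in>idx_G P xbar \<union> J. sw_G P k (\<zeta> t) = 0) \<and>
            (\<forall>k\<in>idx_H P xbar \<union> K. sw_H P k (\<zeta> t) = 0))"
    by (intro exI[of _ \<mu>] conjI exI[of _ "idx_GH P xbar"] exI[of _ \<zeta>] ballI) auto
qed

end
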